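(* Let $n,N\ge 1$, $\sigma>0$, $\rho\in(0,1)$, and let $f_i:\mathbb{R}^n\to\mathbb{R}$, $i=1,\dots,N$, be convex. For each $i$ let constants $L_i\ge 0$ and $p_i\ge L_i$ be given. Starting from arbitrary $\mathbf{w}^{(0)},\mathbf{r}^{(0)}\in(\mathbb{R}^n)^N$, consider the augmented system, for $k\ge 0$, $$\mathbf{w}^{(k+1)}=\rho\,\hat{\mathbf{T}}^{(k)}\mathbf{w}^{(k)}+(1-\rho)\mathbf{w}^{(k)},\qquad \mathbf{r}^{(k+1)}=\hat{\mathbf{F}}^{(k)}(\mathbf{w}^{(k)};\mathbf{r}^{(k)}),$$ where at each iteration $\hat f_i^{(k)}\in\mathcal{S}_{L_i,p_i}(f_i,r_i^{(k)})$ is a surrogate of $f_i$ near $r_i^{(k)}$ for $i=1,\dots,N$, and $\hat{\mathbf{F}}^{(k)},\hat{\mathbf{T}}^{(k)}$ are the operators built from the proximal maps of the $\hat f_i^{(k)}$ as in the context. Then: (i) If $(\mathbf{w}^*,\mathbf{r}^* )$ is a fixed point of the augmented system, then $\mathbf{w}^*$ is a solution of the MACE equation $\mathbf{F}(\mathbf{w}^* )=\mathbf{G}(\mathbf{w}^* )$, where $\mathbf{F}$ is built from the proximal maps of the original functions $f_i$. (ii) If a fixed point exists, then the iterates $(\mathbf{w}^{(k)},\mathbf{r}^{(k)})$ converge to a fixed point $(\mathbf{w}^*,\mathbf{r}^* )$ of the augmented system, and hence $\mathbf{w}^{(k)}$ converges to a solution of the MACE equation.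
   Context: Surrogates: let $f:\mathbb{R}^n\to\mathbb{R}$ be convex, $\xi\in\mathbb{R}^n$, $L\ge0$, $p\ge L$. $\mathcal{S}_{L,p}(f,\xi)$ is the set of functions $\hat f:\mathbb{R}^n\to\mathbb{R}$ (surrogates of $f$ near $\xi$) such that: (majorization) $\hat f(x)\ge f(x)$ for all $x\in\mathbb{R}^n$; (smoothness) $e:=\hat f-f$ is differentiable with $L$-Lipschitz continuous gradient, $e(\xi)=0$ and $\nabla e(\xi)=0$; (strong convexity) $\hat f$ is $p$-strongly convex. Neither $f$ nor $\hat f$ is required to be differentiable, and no continuity of the surrogates in $\xi$ is required. Proximal map: for convex $h:\mathbb{R}^n\to\mathbb{R}$, the proximal map of $h$ is $v\mapsto \operatorname{argmin}_{r\in\mathbb{R}^n}\{h(r)+\frac{1}{2\sigma^2}\|r-v\|^2\}$, with a fixed $\sigma>0$ common to all agents. $F_i$ denotes the proximal map of $f_i$ and $\hat F_i^{(k)}(\cdot\,;r_i^{(k)})$ the proximal map of $\hat f_i^{(k)}$. Stacked operators: for $\mathbf{w}=[w_1,\dots,w_N]\in(\mathbb{R}^n)^N$, $\mathbf{F}(\mathbf{w})=[F_1(w_1),\dots,F_N(w_N)]$, $\hat{\mathbf{F}}^{(k)}(\mathbf{w};\mathbf{r}^{(k)})=[\hat F_1^{(k)}(w_1;r_1^{(k)}),\dots,\hat F_N^{(k)}(w_N;r_N^{(k)})]$, $\mathbf{G}(\mathbf{w})=[\overline{\mathbf{w}},\dots,\overline{\mathbf{w}}]$ with $\overline{\mathbf{w}}=\sum_{j=1}^N\upsilon_j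 w_j$, where the weights $\upsilon_j>0$ are fixed and sum to one, and $\hat{\mathbf{T}}^{(k)}=(2\mathbf{G}-I)\,(2\hat{\mathbf{F}}^{(k)}(\cdot\,;\mathbf{r}^{(k)})-I)$. Fixed point: $(\mathbf{w}^*,\mathbf{r}^* )$ is a fixed point of the augmented system if, with surrogates $\hat f_i^*\in\mathcal{S}_{L_i,p_i}(f_i,r_i^* )$, $i=1,\dots,N$, and with $\hat{\mathbf{F}}^*$ the stacked proximal map of the $\hat f_i^*$, one has $\mathbf{r}^*=\hat{\mathbf{F}}^*(\mathbf{w}^* )$ and $\mathbf{w}^*=(2\mathbf{G}-I)(2\hat{\mathbf{F}}^*-I)\mathbf{w}^*$. *)

theory Defs
  imports "HOL-Analysis.Analysis"
begin

text \<open>For \<open>p = 0\<close> this is plain convexity.\<close>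

definition strongly_convex :: "real \<Rightarrow> ('a::real_inner \<Rightarrow> real) \<Rightarrow> bool" where
  "strongly_convex p h \<longleftrightarrow>
     (\<forall>x y. \<forall>u\<ge>0. \<forall>v\<ge>0. u + v = 1 \<longrightarrow>
        h (u *\<^sub>R x + v *\<^sub>R y) \<le> u * h x + v * h y - p / 2 * (u * v) * (norm (x - y))\<^sup>2)"

definition surrogates ::
    "real \<Rightarrow> real \<Rightarrow> ('a::real_inner \<Rightarrow> real) \<Rightarrow> 'a \<Rightarrow> ('a \<Rightarrow> real) set" where
  "surrogates L p f \<xi> =
     {fh. (\<forall>x. f x \<le> fh x) \<and>
          fh \<xi> - f \<xi> = 0 \<and>
          (\<exists>g. (\<forall>x. GDERIV (\<lambda>y. fh y - f y) x :> g x) \<and> lipschitz_on L UNIV g \<and> g \<xi> = 0) \<and>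
          strongly_convex p fh}"

text \<open>\<open>arg_min\<close> picks some minimizer; for finite-valued convex \<open>h\<close> on a Euclidean space and
  \<open>\<sigma> > 0\<close> the minimizer exists and is unique, so the choice is immaterial.\<close>

definition prox :: "real \<Rightarrow> ('a::real_inner \<Rightarrow> real) \<Rightarrow> 'a \<Rightarrow> 'a" where
  "prox \<sigma> h v = arg_min (\<lambda>r. h r + 1 / (2 * \<sigma>\<^sup>2) * (norm (r - v))\<^sup>2) (\<lambda>_. True)"

text \<open>Agents are the elements of the finite index type \<open>'m\<close>; a stacked vector has type
  \<open>'a ^ 'm\<close>.\<close>

definition stacked_prox ::
    "real \<Rightarrow> ('m::finite \<Rightarrow> 'a::real_inner \<Rightarrow> real) \<Rightarrow> 'a ^ 'm \<Rightarrow> 'a ^ 'm" where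
  "stacked_prox \<sigma> f w = (\<chi> i. prox \<sigma> (f i) (w $ i))"

definition averaging :: "('m::finite \<Rightarrow> real) \<Rightarrow> 'a::real_vector ^ 'm \<Rightarrow> 'a ^ 'm" where
  "averaging \<upsilon> w = (\<chi> i. \<Sum>j\<in>UNIV. \<upsilon> j *\<^sub>R (w $ j))"

definition reflection :: "('b::real_vector \<Rightarrow> 'b) \<Rightarrow> 'b \<Rightarrow> 'b" where
  "reflection P w = 2 *\<^sub>R P w - w"

definition mace_operator ::
    "real \<Rightarrow> ('m::finite \<Rightarrow> real) \<Rightarrow> ('m \<Rightarrow> 'a::real_inner \<Rightarrow> real) \<Rightarrow> 'a ^ 'm \<Rightarrow> 'a ^ 'm" where
  "mace_operator \<sigma> \<upsilon> f = reflection (averaging \<upsilon>) \<circ> reflection (stacked_prox \<sigma> f)"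

definition mace_solution ::
    "real \<Rightarrow> ('m::finite \<Rightarrow> real) \<Rightarrow> ('m \<Rightarrow> 'a::real_inner \<Rightarrow> real) \<Rightarrow> 'a ^ 'm \<Rightarrow> bool" where
  "mace_solution \<sigma> \<upsilon> f w \<longleftrightarrow> stacked_prox \<sigma> f w = averaging \<upsilon> w"

definition augmented_fixed_point ::
    "real \<Rightarrow> ('m::finite \<Rightarrow> real) \<Rightarrow> ('m \<Rightarrow> real) \<Rightarrow> ('m \<Rightarrow> real) \<Rightarrow>
     ('m \<Rightarrow> 'a::real_inner \<Rightarrow> real) \<Rightarrow> 'a ^ 'm \<Rightarrow> 'a ^ 'm \<Rightarrow> bool" where
  "augmented_fixed_point \<sigma> \<upsilon> L p f w r \<longleftrightarrow>
     (\<exists>fh. (\<forall>i. fh i \<in> surrogates (L i) (p i) (f i) (r $ i)) \<and>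
           r = stacked_prox \<sigma> fh w \<and>
           w = mace_operator \<sigma> \<upsilon> fh w)"

text \<open>\<open>fh k i\<close> is the surrogate used by agent \<open>i\<close> at iteration \<open>k\<close>; any choice in the surrogate
  class is allowed. The initial values \<open>w 0\<close> and \<open>r 0\<close> are unconstrained.\<close>

definition augmented_iteration ::
    "real \<Rightarrow> real \<Rightarrow> ('m::finite \<Rightarrow> real) \<Rightarrow> ('m \<Rightarrow> real) \<Rightarrow> ('m \<Rightarrow> real) \<Rightarrow>
     ('m \<Rightarrow> 'a::real_inner \<Rightarrow> real) \<Rightarrow> (nat \<Rightarrow> 'm \<Rightarrow> 'a \<Rightarrow> real) \<Rightarrow>
     (nat \<Rightarrow> 'a ^ 'm) \<Rightarrow> (nat \<Rightarrow> 'a ^ 'm) \<Rightarrow> bool" where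
  "augmented_iteration \<sigma> \<rho> \<upsilon> L p f fh w r \<longleftrightarrow>
     (\<forall>k. (\<forall>i. fh k i \<in> surrogates (L i) (p i) (f i) (r k $ i)) \<and>
          w (Suc k) = \<rho> *\<^sub>R mace_operator \<sigma> \<upsilon> (fh k) (w k) + (1 - \<rho>) *\<^sub>R w k \<and>
          r (Suc k) = stacked_prox \<sigma> (fh k) (w k))"

end

theory Submission
  imports Defs
begin

text \<open>Let \<open>ws\<close> solve \<open>F ws = G ws\<close> and put \<open>rs = G ws\<close>. Strong convexity of the surrogates and the
  bound \<open>fh x \<le> f x + L / 2 * (norm (x - r k))\<^sup>2\<close> show that a surrogate proximal step violates the
  firm nonexpansiveness estimate at \<open>rs\<close> by at most the telescoping term
  \<open>\<sigma>\<^sup>2 * L / 2 * ((norm (r k - rs))\<^sup>2 - (norm (r (Suc k) - rs))\<^sup>2)\<close>. As \<open>2 G - I\<close> is an isometry for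
  the norm weighted by \<open>\<upsilon>\<close>, the Lyapunov function
  \<open>V k = (\<Sum>i. \<upsilon> i * ((norm (w k $ i - ws $ i))\<^sup>2 + 2 * \<rho> * \<sigma>\<^sup>2 * L i * (norm (r k $ i - rs $ i))\<^sup>2))\<close>
  decreases in each step by at least \<open>\<rho> * (1 - \<rho>)\<close> times the squared weighted norm of \<open>T (w k) - w k\<close>.
  Hence \<open>T (w k) - w k\<close> tends to 0, which forces \<open>r k - G (w k)\<close> to 0, so every cluster point of \<open>w\<close>
  solves the MACE equation. For \<open>ws\<close> a cluster point, the decreasing sequence \<open>V\<close> tends to 0 along
  a subsequence, hence altogether.\<close>

section \<open>Strong convexity and minimizers\<close>

text \<open>The squared distance satisfies the strong convexity inequality with equality. This
  serves both to compute moduli of convexity and to extract the gain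
  \<open>\<rho> * (1 - \<rho>)\<close> from averaging.\<close>

lemma norm_convex_combination_diff:
  fixes x y a :: "'a::real_inner"
  assumes "u + v = (1::real)"
  shows "(norm (u *\<^sub>R x + v *\<^sub>R y - a))\<^sup>2
    = u * (norm (x - a))\<^sup>2 + v * (norm (y - a))\<^sup>2 - u * v * (norm (x - y))\<^sup>2"
proof -
  have v: "v = 1 - u" using assms by simp
  show ?thesis
    unfolding v power2_norm_eq_inner
    by (simp add: algebra_simps inner_commute)
qed

lemma strongly_convex_add_quadratic:
  assumes "strongly_convex p h"
  shows "strongly_convex (p + c) (\<lambda>x. h x + c / 2 * (norm (x - a))\<^sup>2)"
  unfolding strongly_convex_def
proof (intro allI impI)
  fix x y u v assume uv: "u \<ge> 0" "v \<ge> (0::real)" "u + v = 1"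
  show "h (u *\<^sub>R x + v *\<^sub>R y) + c / 2 * (norm (u *\<^sub>R x + v *\<^sub>R y - a))\<^sup>2
     \<le> u * (h x + c / 2 * (norm (x - a))\<^sup>2) + v * (h y + c / 2 * (norm (y - a))\<^sup>2)
       - (p + c) / 2 * (u * v) * (norm (x - y))\<^sup>2"
    using assms[unfolded strongly_convex_def, rule_format, OF uv, of x y]
    unfolding norm_convex_combination_diff[OF uv(3)] by (simp add: algebra_simps add_divide_distrib diff_divide_distrib)
qed

lemma strongly_convex_imp_convex_on:
  fixes h :: "'a::real_inner \<Rightarrow> real"
  assumes "strongly_convex p h" "p \<ge> 0"
  shows "convex_on UNIV h"
  unfolding convex_on_def
proof (intro conjI ballI allI impI)
  fix x y :: 'a and u v :: real assume uv: "u \<ge> 0" "v \<ge> 0" "u + v = 1"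
  have "0 \<le> p / 2 * (u * v) * (norm (x - y))\<^sup>2" using assms uv by simp
  then show "h (u *\<^sub>R x + v *\<^sub>R y) \<le> u * h x + v * h y"
    using assms(1)[unfolded strongly_convex_def, rule_format, OF uv, of x y] by linarith
qed simp

lemma convex_on_imp_strongly_convex_0: "convex_on UNIV h \<Longrightarrow> strongly_convex 0 h"
  by (auto simp: strongly_convex_def convex_on_def)

text \<open>Compare \<open>h r\<close> with the value at
  \<open>(1 - t) *\<^sub>R r + t *\<^sub>R x\<close>, divide by \<open>t\<close>, and let
  \<open>t\<close> tend to 0 from the right.\<close>

lemma strongly_convex_minimizer_growth:
  assumes "strongly_convex p h" and min: "\<And>x. h r \<le> h x"
  shows "h r + p / 2 * (norm (x - r))\<^sup>2 \<le> h x"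
proof -
  let ?b = "\<lambda>t::real. h r + p / 2 * (1 - t) * (norm (x - r))\<^sup>2"
  have "?b t \<le> h x" if t: "0 < t" "t < 1" for t
  proof -
    have "h r \<le> h ((1 - t) *\<^sub>R r + t *\<^sub>R x)" by (rule min)
    also have "\<dots> \<le> (1 - t) * h r + t * h x - p / 2 * ((1 - t) * t) * (norm (r - x))\<^sup>2"
      using assms(1)[unfolded strongly_convex_def, rule_format, of "1 - t" t r x] t by simp
    finally have "t * ?b t \<le> t * h x" by (simp add: algebra_simps norm_minus_commute)
    then show ?thesis using t by simp
  qed
  then have "\<forall>\<^sub>F t in at_right 0. ?b t \<le> h x"
    by (auto simp: eventually_at_right_field intro!: exI[of _ 1])
  moreover have "(?b \<longlongrightarrow> h r + p / 2 * (1 - 0) * (norm (x - r))\<^sup>2) (at_right 0)"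
    by (intro tendsto_intros)
  ultimately have "h r + p / 2 * (1 - 0) * (norm (x - r))\<^sup>2 \<le> h x"
    by (intro tendsto_upperbound) auto
  then show ?thesis by simp
qed

text \<open>Continuity gives a minimizer on a large ball, and outside that ball strong convexity
  keeps \<open>h\<close> above \<open>h 0\<close>.\<close>

lemma strongly_convex_has_minimizer:
  fixes h :: "'a::euclidean_space \<Rightarrow> real"
  assumes sc: "strongly_convex p h" and p: "p > 0"
  shows "\<exists>r. \<forall>x. h r \<le> h x"
proof -
  have "convex_on UNIV h" using strongly_convex_imp_convex_on[OF sc] p by simp
  then have cont: "continuous_on S h" for S
    using convex_on_continuous[of UNIV h] continuous_on_subset by blast
  obtain m where m: "\<And>y. y \<in> cball 0 1 \<Longrightarrow> h m \<le> h y"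
    using continuous_attains_inf[of "cball 0 1" h] cont by (metis cball_eq_empty compact_cball not_one_less_zero)
  \<comment> \<open>Chosen so that \<open>t > R\<close> gives
    \<open>p / 2 * (t - 1) \<ge> h 0 - h m\<close>: the quadratic gain at distance \<open>t\<close>
    then outweighs the possible descent on the unit ball.\<close>
  define R where "R = 1 + 2 * (h 0 - h m) / p"
  have m0: "h m \<le> h 0" using m by simp
  have R: "R \<ge> 1" using m0 p by (simp add: R_def)
  obtain r where r: "\<And>y. y \<in> cball 0 R \<Longrightarrow> h r \<le> h y"
    using continuous_attains_inf[of "cball 0 R" h] cont R
    by (metis cball_eq_empty compact_cball not_one_less_zero not_less dual_order.trans)
  have "h r \<le> h x" for x
  proof (cases "norm x \<le> R")
    case True then show ?thesis using r by simp
  next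
    case False
    define t where "t = norm x"
    have t: "t > R" "t > 1" using False R by (auto simp: t_def)
    have t1: "1 / t \<le> 1" using t by simp
    \<comment> \<open>The segment from 0 to \<open>x\<close> meets the unit sphere at
      \<open>y\<close>. The lower bound \<open>h m \<le> h y\<close> together with strong convexity
      on this segment bounds \<open>h x\<close> from below.\<close>
    define y where "y = (1 / t) *\<^sub>R x"
    have "norm y = 1" using t unfolding y_def t_def by auto
    then have "h m \<le> h y" using m by simp
    also have "h y \<le> (1 - 1 / t) * h 0 + (1 / t) * h x - p / 2 * ((1 - 1 / t) * (1 / t)) * t\<^sup>2"
      using sc[unfolded strongly_convex_def, rule_format, of "1 - 1 / t" "1 / t" 0 x] t t1
      by (simp add: y_def t_def)
    finally have "t * h m \<le> t * ((1 - 1 / t) * h 0 + (1 / t) * h x - p / 2 * ((1 - 1 / t) * (1 / t)) * t\<^sup>2)"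
      using t by simp
    also have "\<dots> = (t - 1) * h 0 + h x - p / 2 * (t - 1) * t"
      using t by (simp add: field_simps power2_eq_square)
    finally have 1: "p / 2 * (t - 1) * t - t * (h 0 - h m) \<le> h x - h 0"
      by (simp add: algebra_simps)
    have "p / 2 * (t - 1) \<ge> h 0 - h m" using t(1) p by (simp add: R_def field_simps)
    then have "t * (p / 2 * (t - 1)) \<ge> t * (h 0 - h m)" using t by simp
    moreover have "p / 2 * (t - 1) * t = t * (p / 2 * (t - 1))" by simp
    ultimately have "h 0 \<le> h x" using 1 by linarith
    moreover have "h r \<le> h 0" using r R by simp
    ultimately show ?thesis by simp
  qed
  then show ?thesis by blast
qed

section \<open>Proximal maps and subgradients\<close>

lemma quadratic_expansion:
  fixes x r v :: "'a::real_inner"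
  shows "1 / (2 * c) * (norm (x - v))\<^sup>2
    = 1 / (2 * c) * (norm (r - v))\<^sup>2 + 1 / c / 2 * (norm (x - r))\<^sup>2 - (v - r) \<bullet> (x - r) / c"
proof -
  have "(norm (x - v))\<^sup>2 = (norm (r - v))\<^sup>2 + (norm (x - r))\<^sup>2 - 2 * ((v - r) \<bullet> (x - r))"
    unfolding power2_norm_eq_inner by (simp add: algebra_simps inner_commute)
  then show ?thesis by (simp add: add_divide_distrib diff_divide_distrib)
qed

text \<open>The proximal objective has modulus \<open>p + 1 / \<sigma>\<^sup>2\<close>. In its
  growth inequality the part \<open>1 / \<sigma>\<^sup>2\<close> cancels against the expansion of
  the quadratic about \<open>r\<close>, so that \<open>(v - r) / \<sigma>\<^sup>2\<close> remains as
  a subgradient of \<open>h\<close> at \<open>r\<close> with modulus \<open>p\<close>.\<close>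

lemma prox_subgradient:
  fixes h :: "'a::euclidean_space \<Rightarrow> real"
  assumes "strongly_convex p h" "p \<ge> 0" "\<sigma> > 0" and r: "prox \<sigma> h v = r"
  shows "h r + (v - r) \<bullet> (x - r) / \<sigma>\<^sup>2 + p / 2 * (norm (x - r))\<^sup>2 \<le> h x"
proof -
  let ?\<phi> = "\<lambda>r. h r + 1 / (2 * \<sigma>\<^sup>2) * (norm (r - v))\<^sup>2"
  have sc: "strongly_convex (p + 1 / \<sigma>\<^sup>2) ?\<phi>"
    using strongly_convex_add_quadratic[OF assms(1), of "1 / \<sigma>\<^sup>2" v] by (simp add: mult.commute)
  obtain m where "\<forall>x. ?\<phi> m \<le> ?\<phi> x"
    using strongly_convex_has_minimizer[OF sc] assms by (auto simp: add_nonneg_pos)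
  \<comment> \<open>\<open>arg_min\<close> is defined by choice, so it attains the minimum only once
    a minimizer \<open>m\<close> is known to exist.\<close>
  then have "?\<phi> (arg_min ?\<phi> (\<lambda>_. True)) \<le> ?\<phi> x" for x
    using arg_min_equality[of "\<lambda>_. True" m ?\<phi>] by simp
  then have "?\<phi> r \<le> ?\<phi> x" for x
    using r unfolding prox_def by blast
  from strongly_convex_minimizer_growth[OF sc this]
  have "?\<phi> r + (p + 1 / \<sigma>\<^sup>2) / 2 * (norm (x - r))\<^sup>2 \<le> ?\<phi> x" .
  then show ?thesis
    using quadratic_expansion[of "\<sigma>\<^sup>2" x v r] by (simp add: algebra_simps add_divide_distrib)
qed

text \<open>Converse of the preceding lemma: the subgradient inequality makes the proximal objective
  grow quadratically away from \<open>r\<close>. The growth is also what identifies the point chosen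
  by \<open>arg_min\<close>, of which at first only the value is known.\<close>

lemma prox_eqI:
  fixes h :: "'a::real_inner \<Rightarrow> real"
  assumes "\<sigma> > 0" and sub: "\<And>x. h r + (v - r) \<bullet> (x - r) / \<sigma>\<^sup>2 \<le> h x"
  shows "prox \<sigma> h v = r"
proof -
  let ?\<phi> = "\<lambda>r. h r + 1 / (2 * \<sigma>\<^sup>2) * (norm (r - v))\<^sup>2"
  have grow: "?\<phi> r + 1 / \<sigma>\<^sup>2 / 2 * (norm (x - r))\<^sup>2 \<le> ?\<phi> x" for x
    using sub[of x] unfolding quadratic_expansion[of "\<sigma>\<^sup>2" x v r] by linarith
  have "?\<phi> r \<le> ?\<phi> x" for x
    by (rule order_trans[OF _ grow]) simp
  then have "?\<phi> (prox \<sigma> h v) = ?\<phi> r"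
    unfolding prox_def by (intro arg_min_equality) auto
  with grow[of "prox \<sigma> h v"] have "1 / \<sigma>\<^sup>2 / 2 * (norm (prox \<sigma> h v - r))\<^sup>2 \<le> 0" by simp
  with assms(1) show ?thesis
    by (simp add: mult_le_0_iff divide_le_0_iff)
qed

section \<open>Surrogates and their proximal steps\<close>

text \<open>The descent lemma. Along the segment from \<open>x\<close> to \<open>y\<close>,
  \<open>e\<close> minus its quadratic model has nonpositive derivative, by Cauchy-Schwarz and the
  Lipschitz bound.\<close>

lemma lipschitz_gradient_upper_bound:
  fixes e :: "'a::real_inner \<Rightarrow> real"
  assumes g: "\<And>x. GDERIV e x :> g x" and lip: "lipschitz_on L UNIV g"
  shows "e y \<le> e x + g x \<bullet> (y - x) + L / 2 * (norm (y - x))\<^sup>2"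
proof -
  define d where "d = y - x"
  let ?\<phi> = "\<lambda>t::real. e (x + t *\<^sub>R d) - t * (g x \<bullet> d) - L / 2 * t\<^sup>2 * (norm d)\<^sup>2"
  let ?\<phi>' = "\<lambda>t::real. (g (x + t *\<^sub>R d) - g x) \<bullet> d - L * t * (norm d)\<^sup>2"
  have \<phi>: "(?\<phi> has_real_derivative ?\<phi>' t) (at t)" for t
  proof -
    have "((\<lambda>t. e (x + t *\<^sub>R d)) has_derivative (\<lambda>s. (s *\<^sub>R d) \<bullet> g (x + t *\<^sub>R d))) (at t)"
      by (rule has_derivative_compose[where g = e and f = "\<lambda>t. x + t *\<^sub>R d", rotated])
        (use g[of "x + t *\<^sub>R d"] in \<open>auto simp: gderiv_def inner_commute intro!: derivative_eq_intros\<close>)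
    then have "((\<lambda>t. e (x + t *\<^sub>R d)) has_real_derivative g (x + t *\<^sub>R d) \<bullet> d) (at t)"
      by (simp add: has_field_derivative_def inner_commute mult_commute_abs)
    then show ?thesis
      by (auto intro!: derivative_eq_intros simp: inner_diff_left)
  qed
  have \<phi>'_le: "?\<phi>' t \<le> 0" if "0 \<le> t" for t
  proof -
    have "(g (x + t *\<^sub>R d) - g x) \<bullet> d \<le> norm (g (x + t *\<^sub>R d) - g x) * norm d"
      by (rule norm_cauchy_schwarz)
    also have "\<dots> \<le> (L * norm (t *\<^sub>R d)) * norm d"
      using lipschitz_onD[OF lip, of "x + t *\<^sub>R d" x] by (intro mult_right_mono) (auto simp: dist_norm)
    finally show ?thesis using that by (simp add: power2_eq_square algebra_simps)
  qed
  have "?\<phi> 1 \<le> ?\<phi> 0"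
  proof (rule DERIV_nonpos_imp_nonincreasing[of 0 1 ?\<phi>])
    fix t :: real assume "0 \<le> t"
    from \<phi> \<phi>'_le[OF this] show "\<exists>y. (?\<phi> has_real_derivative y) (at t) \<and> y \<le> 0"
      by (intro exI conjI)
  qed simp
  then show ?thesis by (simp add: d_def)
qed

text \<open>At \<open>\<xi>\<close> the error \<open>fh - f\<close> and its gradient vanish, so the
  descent lemma leaves only the quadratic term.\<close>

lemma surrogate_le_quadratic:
  assumes "fh \<in> surrogates L p f \<xi>"
  shows "fh x \<le> f x + L / 2 * (norm (x - \<xi>))\<^sup>2"
proof -
  obtain g where g: "\<And>x. GDERIV (\<lambda>y. fh y - f y) x :> g x" "lipschitz_on L UNIV g" "g \<xi> = 0"
    and "fh \<xi> - f \<xi> = 0"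
    using assms unfolding surrogates_def by auto
  then show ?thesis
    using lipschitz_gradient_upper_bound[OF g(1,2), of x \<xi>] by simp
qed

text \<open>The difference \<open>L / 2 * (norm (x - a))\<^sup>2 - e x\<close> is convex because the gradient of
  \<open>e = fh - f\<close> is \<open>L\<close>-Lipschitz, so the quadratic surrogate inherits the modulus of \<open>fh\<close>.\<close>

lemma surrogate_imp_strongly_convex_quadratic:
  fixes f :: "'a::real_inner \<Rightarrow> real"
  assumes "fh \<in> surrogates L p f \<xi>"
  shows "strongly_convex p (\<lambda>x. f x + L / 2 * (norm (x - a))\<^sup>2)"
  unfolding strongly_convex_def
proof (intro allI impI)
  fix x y :: 'a and u v :: real assume uv: "u \<ge> 0" "v \<ge> (0::real)" "u + v = 1"
  obtain g where g: "\<And>x. GDERIV (\<lambda>y. fh y - f y) x :> g x" "lipschitz_on L UNIV g"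
    and sc: "strongly_convex p fh"
    using assms unfolding surrogates_def by auto
  define z where "z = u *\<^sub>R x + v *\<^sub>R y"
  have v: "v = 1 - u" using uv by simp
  have zx: "x - z = v *\<^sub>R (x - y)" and zy: "y - z = (- u) *\<^sub>R (x - y)"
    by (simp_all add: z_def v algebra_simps)
  let ?e = "\<lambda>y. fh y - f y"
  have "u * ?e x + v * ?e y
    \<le> u * (?e z + g z \<bullet> (x - z) + L / 2 * (norm (x - z))\<^sup>2) +
      v * (?e z + g z \<bullet> (y - z) + L / 2 * (norm (y - z))\<^sup>2)"
    using uv lipschitz_gradient_upper_bound[OF g, of _ z] by (intro add_mono mult_left_mono) auto
  also have "\<dots> = ?e z + L / 2 * (u * v) * (norm (x - y))\<^sup>2"
    unfolding zx zy v by (simp add: power_mult_distrib, simp add: field_simps power2_eq_square)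
  finally have e: "u * ?e x + v * ?e y \<le> ?e z + L / 2 * (u * v) * (norm (x - y))\<^sup>2" .
  have "fh z \<le> u * fh x + v * fh y - p / 2 * (u * v) * (norm (x - y))\<^sup>2"
    using sc[unfolded strongly_convex_def, rule_format, OF uv] unfolding z_def .
  with e show "f (u *\<^sub>R x + v *\<^sub>R y) + L / 2 * (norm (u *\<^sub>R x + v *\<^sub>R y - a))\<^sup>2
     \<le> u * (f x + L / 2 * (norm (x - a))\<^sup>2) + v * (f y + L / 2 * (norm (y - a))\<^sup>2)
       - p / 2 * (u * v) * (norm (x - y))\<^sup>2"
    unfolding norm_convex_combination_diff[OF uv(3)] unfolding z_def[symmetric]
    by (simp add: algebra_simps)
qed

text \<open>The error has gradient \<open>L *\<^sub>R (x - a)\<close>, which is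
  \<open>L\<close>-Lipschitz and vanishes at \<open>a\<close>. The modulus is transferred from
  \<open>fh\<close>, whose center \<open>\<xi>\<close> may differ from \<open>a\<close>.\<close>

lemma quadratic_surrogate:
  fixes f :: "'a::real_inner \<Rightarrow> real"
  assumes "fh \<in> surrogates L p f \<xi>" "L \<ge> 0"
  shows "(\<lambda>x. f x + L / 2 * (norm (x - a))\<^sup>2) \<in> surrogates L p f a"
proof -
  have "GDERIV (\<lambda>x. L / 2 * (norm (x - a))\<^sup>2) x :> L *\<^sub>R (x - a)" for x
    unfolding gderiv_def power2_norm_eq_inner
    by (auto intro!: derivative_eq_intros simp: inner_commute algebra_simps)
  moreover have "lipschitz_on L UNIV (\<lambda>x. L *\<^sub>R (x - a))"
    using assms(2) by (intro lipschitz_onI) (simp_all add: dist_norm flip: scaleR_diff_right)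
  moreover have "strongly_convex p (\<lambda>x. f x + L / 2 * (norm (x - a))\<^sup>2)"
    using surrogate_imp_strongly_convex_quadratic[OF assms(1)] .
  ultimately show ?thesis
    using assms(2) unfolding surrogates_def
    by (auto intro!: exI[of _ "\<lambda>x. L *\<^sub>R (x - a)"])
qed

text \<open>Majorization at \<open>r\<close> and the quadratic bound at \<open>x\<close> eliminate
  \<open>fh\<close> from its own subgradient inequality. What remains involves only \<open>f\<close>
  and the center \<open>\<xi>\<close>, whichever surrogate was chosen.\<close>

lemma prox_surrogate_subgradient:
  fixes f :: "'a::euclidean_space \<Rightarrow> real"
  assumes fh: "fh \<in> surrogates L p f \<xi>" and "p \<ge> 0" "\<sigma> > 0" and r: "prox \<sigma> fh v = r"
  shows "f r + (v - r) \<bullet> (x - r) / \<sigma>\<^sup>2 + p / 2 * (norm (x - r))\<^sup>2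
    \<le> f x + L / 2 * (norm (x - \<xi>))\<^sup>2"
proof -
  have "f r \<le> fh r" "strongly_convex p fh" using fh by (auto simp: surrogates_def)
  then show ?thesis
    using prox_subgradient[OF _ assms(2,3) r, of x] surrogate_le_quadratic[OF fh, of x] by linarith
qed

text \<open>For \<open>L = 0\<close> this is firm nonexpansiveness of the proximal map, written with its reflection.\<close>

lemma reflected_prox_surrogate_bound:
  fixes f :: "'a::euclidean_space \<Rightarrow> real"
  assumes fh: "fh \<in> surrogates L p f \<xi>" and "L \<ge> 0" "p \<ge> L" "\<sigma> > 0"
    and f: "convex_on UNIV f"
    and r: "prox \<sigma> fh v = r" and rs: "prox \<sigma> f vs = rs"
  shows "(norm (2 *\<^sub>R (r - rs) - (v - vs)))\<^sup>2
    \<le> (norm (v - vs))\<^sup>2 - 2 * \<sigma>\<^sup>2 * L * ((norm (r - rs))\<^sup>2 - (norm (\<xi> - rs))\<^sup>2)"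
proof -
  define s d where "s = r - rs" and "d = v - vs"
  \<comment> \<open>The surrogate step is tested at \<open>rs\<close>, and below the subgradient
    inequality of \<open>f\<close> at \<open>rs\<close> is tested at \<open>r\<close>. The values of
    \<open>f\<close> cancel in the sum.\<close>
  have 1: "f r + (v - r) \<bullet> (rs - r) / \<sigma>\<^sup>2 + p / 2 * (norm (rs - r))\<^sup>2
    \<le> f rs + L / 2 * (norm (rs - \<xi>))\<^sup>2"
    using prox_surrogate_subgradient[OF fh _ \<open>\<sigma> > 0\<close> r] assms by simp
  have 2: "f rs + (vs - rs) \<bullet> (r - rs) / \<sigma>\<^sup>2 \<le> f r"
    using prox_subgradient[OF convex_on_imp_strongly_convex_0[OF f] _ \<open>\<sigma> > 0\<close> rs, of r] by simp
  \<comment> \<open>With \<open>p\<close> lowered to \<open>L\<close>, both squared distances carry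
    the same coefficient, as telescoping demands.\<close>
  have "L / 2 * (norm s)\<^sup>2 \<le> p / 2 * (norm s)\<^sup>2" using assms by (intro mult_right_mono) auto
  moreover have "(v - r) \<bullet> (rs - r) + (vs - rs) \<bullet> (r - rs) = s \<bullet> s - d \<bullet> s"
    by (simp add: s_def d_def algebra_simps inner_commute)
  then have "(v - r) \<bullet> (rs - r) / \<sigma>\<^sup>2 + (vs - rs) \<bullet> (r - rs) / \<sigma>\<^sup>2 = (s \<bullet> s - d \<bullet> s) / \<sigma>\<^sup>2"
    by (metis add_divide_distrib)
  ultimately have "(s \<bullet> s - d \<bullet> s) / \<sigma>\<^sup>2 \<le> L / 2 * ((norm (\<xi> - rs))\<^sup>2 - (norm s)\<^sup>2)"
    using 1 2 unfolding norm_minus_commute[of rs r] norm_minus_commute[of rs \<xi>] s_def[symmetric]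
    by (simp add: right_diff_distrib)
  then have "s \<bullet> s - d \<bullet> s \<le> L / 2 * ((norm (\<xi> - rs))\<^sup>2 - (norm s)\<^sup>2) * \<sigma>\<^sup>2"
    using \<open>\<sigma> > 0\<close> by (simp add: pos_divide_le_eq)
  moreover have "(norm (2 *\<^sub>R s - d))\<^sup>2 = (norm d)\<^sup>2 + 4 * (s \<bullet> s - d \<bullet> s)"
    unfolding power2_norm_eq_inner by (simp add: algebra_simps inner_commute)
  ultimately have "(norm (2 *\<^sub>R s - d))\<^sup>2
      \<le> (norm d)\<^sup>2 + 4 * (L / 2 * ((norm (\<xi> - rs))\<^sup>2 - (norm s)\<^sup>2) * \<sigma>\<^sup>2)"
    by (simp only: add_le_cancel_left mult_le_cancel_left_pos zero_less_numeral)
  also have "\<dots> = (norm d)\<^sup>2 - 2 * \<sigma>\<^sup>2 * L * ((norm s)\<^sup>2 - (norm (\<xi> - rs))\<^sup>2)"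
    by (simp add: algebra_simps)
  finally show ?thesis by (simp add: s_def d_def)
qed

section \<open>The averaging operator and the MACE equation\<close>

lemma averaging_add: "averaging \<upsilon> (x + y) = averaging \<upsilon> x + averaging \<upsilon> y"
  by (simp add: averaging_def vec_eq_iff scaleR_add_right sum.distrib)

lemma averaging_diff: "averaging \<upsilon> (x - y) = averaging \<upsilon> x - averaging \<upsilon> y"
  by (simp add: averaging_def vec_eq_iff scaleR_diff_right sum_subtractf)

lemma averaging_scaleR: "averaging \<upsilon> (c *\<^sub>R x) = c *\<^sub>R averaging \<upsilon> x"
  by (simp add: averaging_def vec_eq_iff scaleR_sum_right mult.commute)

lemma averaging_idem: "(\<Sum>i\<in>UNIV. \<upsilon> i) = 1 \<Longrightarrow> averaging \<upsilon> (averaging \<upsilon> x) = averaging \<upsilon> x"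
  by (simp add: averaging_def vec_eq_iff flip: scaleR_left.sum)

lemma tendsto_averaging:
  fixes x :: "nat \<Rightarrow> 'a::real_normed_vector ^ 'm::finite"
  assumes "x \<longlonglongrightarrow> l"
  shows "(\<lambda>k. averaging \<upsilon> (x k)) \<longlonglongrightarrow> averaging \<upsilon> l"
  unfolding averaging_def using assms by (intro tendsto_intros)

text \<open>With \<open>z = 2 r - w\<close>, a fixed point means \<open>G z = r\<close>. Then
  \<open>r\<close> lies in the range of the idempotent \<open>G\<close>, so \<open>G r = r\<close>,
  and \<open>G z = 2 G r - G w\<close> yields \<open>r = G w\<close>. The equivalence is applied to
  \<open>f\<close> as well as to its surrogates.\<close>

lemma mace_operator_fixed_iff:
  assumes "(\<Sum>i\<in>UNIV. \<upsilon> i) = 1"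
  shows "mace_operator \<sigma> \<upsilon> f w = w \<longleftrightarrow> mace_solution \<sigma> \<upsilon> f w"
proof -
  define r where "r = stacked_prox \<sigma> f w"
  let ?z = "2 *\<^sub>R r - w"
  have G: "averaging \<upsilon> ?z = 2 *\<^sub>R averaging \<upsilon> r - averaging \<upsilon> w"
    by (simp add: averaging_diff averaging_scaleR)
  have "mace_operator \<sigma> \<upsilon> f w = w \<longleftrightarrow> 2 *\<^sub>R averaging \<upsilon> ?z = 2 *\<^sub>R r"
    by (auto simp: mace_operator_def reflection_def r_def algebra_simps)
  also have "\<dots> \<longleftrightarrow> averaging \<upsilon> ?z = r" by simp
  also have "\<dots> \<longleftrightarrow> r = averaging \<upsilon> w"
  proof
    assume z: "averaging \<upsilon> ?z = r"
    then have "averaging \<upsilon> r = r" using averaging_idem[OF assms] by metis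
    with z G show "r = averaging \<upsilon> w" by (simp add: algebra_simps scaleR_2)
  next
    assume "r = averaging \<upsilon> w"
    then show "averaging \<upsilon> ?z = r" using G averaging_idem[OF assms, of w] by (simp add: scaleR_2)
  qed
  finally show ?thesis by (simp add: mace_solution_def r_def)
qed

section \<open>The weighted norm\<close>

text \<open>The weights \<open>\<upsilon>\<close> replace the standard norm of
  \<open>'a ^ 'm\<close> so that \<open>2 G - I\<close> becomes an isometry. The weights
  \<open>\<upsilon> i * L i\<close>, which may vanish, are used too.\<close>

definition weighted_sqnorm :: "('m::finite \<Rightarrow> real) \<Rightarrow> 'a::real_normed_vector ^ 'm \<Rightarrow> real" where
  "weighted_sqnorm \<upsilon> x = (\<Sum>i\<in>UNIV. \<upsilon> i * (norm (x $ i))\<^sup>2)"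

lemma weighted_sqnorm_nonneg: "(\<And>i. \<upsilon> i \<ge> 0) \<Longrightarrow> weighted_sqnorm \<upsilon> x \<ge> 0"
  by (simp add: weighted_sqnorm_def sum_nonneg)

lemma component_le_weighted_sqnorm:
  assumes "\<And>i. \<upsilon> i > 0"
  shows "(norm (x $ i))\<^sup>2 \<le> weighted_sqnorm \<upsilon> x / \<upsilon> i"
proof -
  have "\<upsilon> i * (norm (x $ i))\<^sup>2 \<le> weighted_sqnorm \<upsilon> x"
    unfolding weighted_sqnorm_def
    using assms by (intro member_le_sum) (auto simp: less_imp_le)
  then show ?thesis using assms[of i] by (simp add: pos_le_divide_eq mult.commute)
qed

lemma tendsto_zero_weighted_sqnorm:
  assumes pos: "\<And>i. \<upsilon> i > 0" and lim: "(\<lambda>k. weighted_sqnorm \<upsilon> (x k)) \<longlonglongrightarrow> 0"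
  shows "x \<longlonglongrightarrow> 0"
proof (rule vec_tendstoI)
  fix i
  have "(\<lambda>k. weighted_sqnorm \<upsilon> (x k) / \<upsilon> i) \<longlonglongrightarrow> 0"
    using tendsto_divide[OF lim tendsto_const, of "\<upsilon> i"] pos[of i] by simp
  then have "(\<lambda>k. (norm (x k $ i))\<^sup>2) \<longlonglongrightarrow> 0"
    by (rule Lim_null_comparison[rotated])
      (use component_le_weighted_sqnorm[OF pos] in \<open>auto intro!: always_eventually\<close>)
  then show "(\<lambda>k. x k $ i) \<longlonglongrightarrow> 0 $ i"
    using tendsto_real_sqrt by (fastforce simp: tendsto_norm_zero_iff)
qed

text \<open>\<open>G\<close> is the orthogonal projection onto constant vectors for the
  \<open>\<upsilon>\<close>-weighted inner product, so \<open>2 G - I\<close> is a reflection.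
  Concretely, the cross term sums to \<open>4 * (g \<bullet> g)\<close> and cancels.\<close>

lemma weighted_sqnorm_reflection_averaging:
  fixes x :: "'a::real_inner ^ 'm::finite"
  assumes "(\<Sum>i\<in>UNIV. \<upsilon> i) = 1"
  shows "weighted_sqnorm \<upsilon> (reflection (averaging \<upsilon>) x) = weighted_sqnorm \<upsilon> x"
proof -
  define g where "g = (\<Sum>i\<in>UNIV. \<upsilon> i *\<^sub>R (x $ i))"
  have g_inner: "(\<Sum>i\<in>UNIV. g \<bullet> (\<upsilon> i *\<^sub>R (x $ i))) = g \<bullet> g"
    unfolding inner_sum_right[symmetric] g_def[symmetric] ..
  have norm_reflection: "(norm (reflection (averaging \<upsilon>) x $ i))\<^sup>2
      = 4 * (g \<bullet> g) - 4 * (g \<bullet> (x $ i)) + (norm (x $ i))\<^sup>2" for i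
    unfolding power2_norm_eq_inner
    by (simp add: reflection_def averaging_def g_def[symmetric] algebra_simps inner_commute)
  have "weighted_sqnorm \<upsilon> (reflection (averaging \<upsilon>) x)
      = (\<Sum>i\<in>UNIV. \<upsilon> i * (4 * (g \<bullet> g)) - 4 * (g \<bullet> (\<upsilon> i *\<^sub>R (x $ i))) + \<upsilon> i * (norm (x $ i))\<^sup>2)"
    unfolding weighted_sqnorm_def norm_reflection by (intro sum.cong) (simp_all add: algebra_simps)
  also have "\<dots> = (\<Sum>i\<in>UNIV. \<upsilon> i) * (4 * (g \<bullet> g)) - 4 * (g \<bullet> g) + weighted_sqnorm \<upsilon> x"
    unfolding weighted_sqnorm_def
    by (simp only: sum.distrib sum_subtractf sum_distrib_left[symmetric] sum_distrib_right[symmetric] g_inner)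
  finally show ?thesis using assms by simp
qed

lemma weighted_sqnorm_convex_combination:
  fixes x y :: "'a::real_inner ^ 'm::finite"
  assumes "u + v = 1"
  shows "weighted_sqnorm \<upsilon> (u *\<^sub>R x + v *\<^sub>R y - a)
    = u * weighted_sqnorm \<upsilon> (x - a) + v * weighted_sqnorm \<upsilon> (y - a)
      - u * v * weighted_sqnorm \<upsilon> (x - y)"
  unfolding weighted_sqnorm_def sum_distrib_left sum.distrib[symmetric] sum_subtractf[symmetric]
  by (intro sum.cong refl) (simp add: norm_convex_combination_diff[OF assms], simp add: algebra_simps)

section \<open>Fixed points and solutions of the MACE equation\<close>

locale mace =
  fixes f :: "'m::finite \<Rightarrow> 'a::euclidean_space \<Rightarrow> real"
    and L p \<upsilon> :: "'m \<Rightarrow> real"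
    and \<sigma> \<rho> :: real
  assumes \<sigma>: "\<sigma> > 0"
    and \<rho>: "0 < \<rho>" "\<rho> < 1"
    and \<upsilon>: "\<upsilon> i > 0" "(\<Sum>i\<in>UNIV. \<upsilon> i) = 1"
    and convex: "convex_on UNIV (f i)"
    and L: "L i \<ge> 0"
    and p: "p i \<ge> L i"
begin

lemma sqnorm_nonneg: "weighted_sqnorm \<upsilon> x \<ge> 0"
  using \<upsilon>(1) by (simp add: weighted_sqnorm_nonneg less_imp_le)

text \<open>When the surrogate is centered at its own proximal point, both quadratic terms are
  centered at \<open>r\<close>, and \<open>p i \<ge> L i\<close> absorbs the error. The subgradient
  inequality of \<open>f i\<close> is left.\<close>

lemma prox_surrogate_fixed:
  assumes fh: "fh \<in> surrogates (L i) (p i) (f i) r" and r: "prox \<sigma> fh v = r"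
  shows "prox \<sigma> (f i) v = r"
proof (rule prox_eqI[OF \<sigma>])
  fix x
  have "f i r + (v - r) \<bullet> (x - r) / \<sigma>\<^sup>2 + p i / 2 * (norm (x - r))\<^sup>2
    \<le> f i x + L i / 2 * (norm (x - r))\<^sup>2"
    using L[of i] p[of i] by (intro prox_surrogate_subgradient[OF fh _ \<sigma> r]) simp
  moreover have "L i / 2 * (norm (x - r))\<^sup>2 \<le> p i / 2 * (norm (x - r))\<^sup>2"
    using p by (intro mult_right_mono) auto
  ultimately show "f i r + (v - r) \<bullet> (x - r) / \<sigma>\<^sup>2 \<le> f i x" by linarith
qed

lemma augmented_fixed_point_imp_mace_solution:
  assumes "augmented_fixed_point \<sigma> \<upsilon> L p f ws rs"
  shows "mace_solution \<sigma> \<upsilon> f ws"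
proof -
  obtain fh where fh: "\<And>i. fh i \<in> surrogates (L i) (p i) (f i) (rs $ i)"
    and rs: "rs = stacked_prox \<sigma> fh ws" and ws: "ws = mace_operator \<sigma> \<upsilon> fh ws"
    using assms unfolding augmented_fixed_point_def by auto
  have "rs = averaging \<upsilon> ws"
    using mace_operator_fixed_iff[OF \<upsilon>(2), of \<sigma> fh ws] rs ws by (simp add: mace_solution_def)
  moreover have "stacked_prox \<sigma> f ws = rs"
    using prox_surrogate_fixed[OF fh] rs by (simp add: stacked_prox_def vec_eq_iff)
  ultimately show ?thesis by (simp add: mace_solution_def)
qed

text \<open>The class of surrogates at \<open>rs\<close> could a priori be empty; a surrogate near any other point
  forces enough strong convexity of \<open>f\<close> for the quadratic surrogate at \<open>rs\<close> to be admissible.\<close>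

lemma mace_solution_imp_augmented_fixed_point:
  assumes sol: "mace_solution \<sigma> \<upsilon> f ws"
    and fh: "\<And>i. fh i \<in> surrogates (L i) (p i) (f i) (\<xi> i)"
  shows "augmented_fixed_point \<sigma> \<upsilon> L p f ws (averaging \<upsilon> ws)"
proof -
  define rs where "rs = averaging \<upsilon> ws"
  define q where "q i x = f i x + L i / 2 * (norm (x - rs $ i))\<^sup>2" for i x
  have q: "q i \<in> surrogates (L i) (p i) (f i) (rs $ i)" for i
    unfolding q_def by (rule quadratic_surrogate[OF fh L])
  have "prox \<sigma> (q i) (ws $ i) = rs $ i" for i
  proof (rule prox_eqI[OF \<sigma>])
    fix x
    have "prox \<sigma> (f i) (ws $ i) = rs $ i"
      using sol unfolding mace_solution_def stacked_prox_def rs_def by (metis vec_lambda_beta)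
    from prox_subgradient[OF convex_on_imp_strongly_convex_0[OF convex] _ \<sigma> this, of x]
    have "f i (rs $ i) + (ws $ i - rs $ i) \<bullet> (x - rs $ i) / \<sigma>\<^sup>2 \<le> f i x" by simp
    \<comment> \<open>The quadratic vanishes at \<open>rs $ i\<close> and is nonnegative elsewhere,
      so a subgradient of \<open>f i\<close> there is also one of \<open>q i\<close>.\<close>
    also have "f i x \<le> q i x" using L[of i] by (simp add: q_def)
    finally show "q i (rs $ i) + (ws $ i - rs $ i) \<bullet> (x - rs $ i) / \<sigma>\<^sup>2 \<le> q i x"
      by (simp add: q_def)
  qed
  then have "stacked_prox \<sigma> q ws = rs" by (simp add: stacked_prox_def vec_eq_iff)
  moreover from this have "mace_operator \<sigma> \<upsilon> q ws = ws"
    using mace_operator_fixed_iff[OF \<upsilon>(2), of \<sigma> q ws] by (simp add: mace_solution_def rs_def)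
  ultimately show ?thesis
    using q unfolding augmented_fixed_point_def rs_def[symmetric] by (intro exI[of _ q]) simp
qed

section \<open>Decrease of the Lyapunov function\<close>

text \<open>The factor \<open>2 * \<rho> * \<sigma>\<^sup>2\<close> is the coefficient of the
  telescoping term after the bound on the operator is averaged with weight
  \<open>\<rho>\<close>.\<close>

definition lyapunov :: "'a ^ 'm \<Rightarrow> 'a ^ 'm \<Rightarrow> 'a ^ 'm \<Rightarrow> real" where
  "lyapunov ws w r = weighted_sqnorm \<upsilon> (w - ws)
     + 2 * \<rho> * \<sigma>\<^sup>2 * weighted_sqnorm (\<lambda>i. \<upsilon> i * L i) (r - averaging \<upsilon> ws)"

lemma weighted_sqnorm_le_lyapunov: "weighted_sqnorm \<upsilon> (w - ws) \<le> lyapunov ws w r"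
  using \<rho> \<upsilon>(1) L by (simp add: lyapunov_def weighted_sqnorm_nonneg less_imp_le)

lemma lyapunov_nonneg: "lyapunov ws w r \<ge> 0"
  using sqnorm_nonneg weighted_sqnorm_le_lyapunov by (rule order_trans)

lemma tendsto_lyapunov:
  assumes "w \<longlonglongrightarrow> ws" "r \<longlonglongrightarrow> averaging \<upsilon> ws"
  shows "(\<lambda>k. lyapunov ws (w k) (r k)) \<longlonglongrightarrow> 0"
proof -
  have "(\<lambda>k. lyapunov ws (w k) (r k)) \<longlonglongrightarrow> lyapunov ws ws (averaging \<upsilon> ws)"
    unfolding lyapunov_def weighted_sqnorm_def by (intro tendsto_intros assms)
  then show ?thesis by (simp add: lyapunov_def weighted_sqnorm_def)
qed

text \<open>As \<open>ws\<close> is fixed by the operator built from \<open>f\<close>, the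
  difference is \<open>2 G - I\<close> applied to a difference of reflected proximal points. The
  isometry removes \<open>2 G - I\<close>, and the estimate for a single agent is summed.\<close>

lemma mace_operator_bound:
  assumes sol: "mace_solution \<sigma> \<upsilon> f ws"
    and fh: "\<And>i. fh i \<in> surrogates (L i) (p i) (f i) (r $ i)"
  shows "weighted_sqnorm \<upsilon> (mace_operator \<sigma> \<upsilon> fh w - ws) \<le> weighted_sqnorm \<upsilon> (w - ws)
    - 2 * \<sigma>\<^sup>2 * (weighted_sqnorm (\<lambda>i. \<upsilon> i * L i) (stacked_prox \<sigma> fh w - averaging \<upsilon> ws)
      - weighted_sqnorm (\<lambda>i. \<upsilon> i * L i) (r - averaging \<upsilon> ws))"
proof -
  define rs s where "rs = averaging \<upsilon> ws" and "s = stacked_prox \<sigma> fh w"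
  let ?d = "2 *\<^sub>R (s - rs) - (w - ws)"
  have rs: "stacked_prox \<sigma> f ws = rs" using sol by (simp add: mace_solution_def rs_def)
  have "mace_operator \<sigma> \<upsilon> f ws = ws"
    using sol mace_operator_fixed_iff[OF \<upsilon>(2)] by blast
  then have "mace_operator \<sigma> \<upsilon> fh w - ws = mace_operator \<sigma> \<upsilon> fh w - mace_operator \<sigma> \<upsilon> f ws"
    by simp
  also have "\<dots> = reflection (averaging \<upsilon>) ?d"
    by (simp add: mace_operator_def reflection_def rs s_def averaging_add averaging_diff averaging_scaleR algebra_simps)
  finally have "weighted_sqnorm \<upsilon> (mace_operator \<sigma> \<upsilon> fh w - ws) = weighted_sqnorm \<upsilon> ?d"
    by (simp only: weighted_sqnorm_reflection_averaging[OF \<upsilon>(2)])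
  also have "\<dots> \<le> (\<Sum>i\<in>UNIV. \<upsilon> i * ((norm ((w - ws) $ i))\<^sup>2
      - 2 * \<sigma>\<^sup>2 * L i * ((norm ((s - rs) $ i))\<^sup>2 - (norm ((r - rs) $ i))\<^sup>2)))"
    unfolding weighted_sqnorm_def
  proof (intro sum_mono mult_left_mono)
    fix i
    have "prox \<sigma> (fh i) (w $ i) = s $ i" "prox \<sigma> (f i) (ws $ i) = rs $ i"
      using rs by (auto simp: s_def stacked_prox_def vec_eq_iff)
    from reflected_prox_surrogate_bound[OF fh L p \<sigma> convex this]
    show "(norm (?d $ i))\<^sup>2 \<le> (norm ((w - ws) $ i))\<^sup>2
      - 2 * \<sigma>\<^sup>2 * L i * ((norm ((s - rs) $ i))\<^sup>2 - (norm ((r - rs) $ i))\<^sup>2)"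
      by simp
  qed (use \<upsilon>(1) in \<open>simp add: less_imp_le\<close>)
  also have "\<dots> = weighted_sqnorm \<upsilon> (w - ws) - 2 * \<sigma>\<^sup>2 *
      (weighted_sqnorm (\<lambda>i. \<upsilon> i * L i) (s - rs) - weighted_sqnorm (\<lambda>i. \<upsilon> i * L i) (r - rs))"
    unfolding weighted_sqnorm_def sum_distrib_left sum.distrib[symmetric] sum_subtractf[symmetric]
    by (intro sum.cong refl) (simp add: algebra_simps)
  finally show ?thesis by (simp only: rs_def s_def)
qed

lemma lyapunov_decrease:
  fixes w r :: "'a ^ 'm"
  assumes sol: "mace_solution \<sigma> \<upsilon> f ws"
    and fh: "\<And>i. fh i \<in> surrogates (L i) (p i) (f i) (r $ i)"
  defines "T \<equiv> mace_operator \<sigma> \<upsilon> fh w"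
  shows "lyapunov ws (\<rho> *\<^sub>R T + (1 - \<rho>) *\<^sub>R w) (stacked_prox \<sigma> fh w)
    + \<rho> * (1 - \<rho>) * weighted_sqnorm \<upsilon> (T - w) \<le> lyapunov ws w r"
proof -
  let ?W = "weighted_sqnorm (\<lambda>i. \<upsilon> i * L i)"
  let ?s = "stacked_prox \<sigma> fh w" and ?rs = "averaging \<upsilon> ws"
  have "\<rho> * weighted_sqnorm \<upsilon> (T - ws)
    \<le> \<rho> * (weighted_sqnorm \<upsilon> (w - ws) - 2 * \<sigma>\<^sup>2 * (?W (?s - ?rs) - ?W (r - ?rs)))"
    unfolding T_def using \<rho> by (intro mult_left_mono mace_operator_bound[OF sol fh]) auto
  then show ?thesis
    unfolding lyapunov_def
    using weighted_sqnorm_convex_combination[of \<rho> "1 - \<rho>" \<upsilon> T w ws]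
    by (simp add: algebra_simps)
qed

section \<open>Convergence of the iteration\<close>

context
  fixes fh :: "nat \<Rightarrow> 'm \<Rightarrow> 'a \<Rightarrow> real" and w r :: "nat \<Rightarrow> 'a ^ 'm"
  assumes iter: "augmented_iteration \<sigma> \<rho> \<upsilon> L p f fh w r"
begin

lemma iter_surrogate: "fh k i \<in> surrogates (L i) (p i) (f i) (r k $ i)"
  and iter_w: "w (Suc k) = \<rho> *\<^sub>R mace_operator \<sigma> \<upsilon> (fh k) (w k) + (1 - \<rho>) *\<^sub>R w k"
  and iter_r: "r (Suc k) = stacked_prox \<sigma> (fh k) (w k)"
  using iter unfolding augmented_iteration_def by auto

lemma lyapunov_iter:
  assumes "mace_solution \<sigma> \<upsilon> f ws"
  shows "lyapunov ws (w (Suc k)) (r (Suc k))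
    + \<rho> * (1 - \<rho>) * weighted_sqnorm \<upsilon> (mace_operator \<sigma> \<upsilon> (fh k) (w k) - w k)
    \<le> lyapunov ws (w k) (r k)"
  unfolding iter_w iter_r by (rule lyapunov_decrease[OF assms iter_surrogate])

lemma lyapunov_decseq:
  assumes "mace_solution \<sigma> \<upsilon> f ws"
  shows "decseq (\<lambda>k. lyapunov ws (w k) (r k))"
proof (rule decseq_SucI)
  fix k
  have "0 \<le> \<rho> * (1 - \<rho>) * weighted_sqnorm \<upsilon> (mace_operator \<sigma> \<upsilon> (fh k) (w k) - w k)"
    using \<rho> by (simp add: sqnorm_nonneg)
  then show "lyapunov ws (w (Suc k)) (r (Suc k)) \<le> lyapunov ws (w k) (r k)"
    using lyapunov_iter[OF assms, of k] by linarith
qed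

lemma lyapunov_convergent:
  assumes "mace_solution \<sigma> \<upsilon> f ws"
  obtains l where "(\<lambda>k. lyapunov ws (w k) (r k)) \<longlonglongrightarrow> l"
  using decseq_convergent[OF lyapunov_decseq[OF assms], of 0] lyapunov_nonneg that by metis

text \<open>Up to the factor \<open>\<rho> * (1 - \<rho>)\<close>, the residual is bounded by
  consecutive differences of a convergent sequence.\<close>

lemma mace_residual_tendsto_0:
  assumes sol: "mace_solution \<sigma> \<upsilon> f ws"
  shows "(\<lambda>k. mace_operator \<sigma> \<upsilon> (fh k) (w k) - w k) \<longlonglongrightarrow> 0"
proof (rule tendsto_zero_weighted_sqnorm[OF \<upsilon>(1)])
  let ?V = "\<lambda>k. lyapunov ws (w k) (r k)"
  obtain l where l: "?V \<longlonglongrightarrow> l" using lyapunov_convergent[OF sol] .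
  have "(\<lambda>k. (?V k - ?V (Suc k)) / (\<rho> * (1 - \<rho>))) \<longlonglongrightarrow> (l - l) / (\<rho> * (1 - \<rho>))"
    using \<rho> by (intro tendsto_intros l LIMSEQ_Suc) auto
  then have "(\<lambda>k. (?V k - ?V (Suc k)) / (\<rho> * (1 - \<rho>))) \<longlonglongrightarrow> 0" by simp
  then show "(\<lambda>k. weighted_sqnorm \<upsilon> (mace_operator \<sigma> \<upsilon> (fh k) (w k) - w k)) \<longlonglongrightarrow> 0"
  proof (rule Lim_null_comparison[rotated], intro always_eventually allI)
    fix k
    show "norm (weighted_sqnorm \<upsilon> (mace_operator \<sigma> \<upsilon> (fh k) (w k) - w k))
      \<le> (?V k - ?V (Suc k)) / (\<rho> * (1 - \<rho>))"
      using lyapunov_iter[OF sol, of k] \<rho>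
      by (simp add: pos_le_divide_eq sqnorm_nonneg abs_of_nonneg mult.commute)
  qed
qed

lemma iter_consensus:
  assumes sol: "mace_solution \<sigma> \<upsilon> f ws"
  shows "(\<lambda>k. r (Suc k) - averaging \<upsilon> (w k)) \<longlonglongrightarrow> 0"
    and "(\<lambda>k. r k - averaging \<upsilon> (w k)) \<longlonglongrightarrow> 0"
proof -
  let ?G = "averaging \<upsilon>"
  define D where "D k = mace_operator \<sigma> \<upsilon> (fh k) (w k) - w k" for k
  have D: "D \<longlonglongrightarrow> 0" using mace_residual_tendsto_0[OF sol] by (simp add: D_def[abs_def])
  have GD: "(\<lambda>k. ?G (D k)) \<longlonglongrightarrow> 0"
    using tendsto_averaging[OF D, of \<upsilon>] by (simp add: averaging_def vec_eq_iff zero_vec_def)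
  have D_eq: "D k = 2 *\<^sub>R (2 *\<^sub>R ?G (r (Suc k)) - ?G (w k) - r (Suc k))" for k
    by (simp add: D_def mace_operator_def reflection_def iter_r averaging_diff averaging_scaleR
        algebra_simps)
  then have GD_eq: "?G (D k) = 2 *\<^sub>R (?G (r (Suc k)) - ?G (w k))" for k
    by (simp add: averaging_diff averaging_scaleR averaging_idem[OF \<upsilon>(2)])
      (simp add: scaleR_2)
  \<comment> \<open>Eliminates \<open>G (r (Suc k))\<close> between the formulas for
    \<open>D k\<close> and \<open>G (D k)\<close>.\<close>
  have "r (Suc k) - ?G (w k) = ?G (D k) - (1 / 2) *\<^sub>R D k" for k
    unfolding GD_eq unfolding D_eq by (simp add: scaleR_2)
  then show 1: "(\<lambda>k. r (Suc k) - ?G (w k)) \<longlonglongrightarrow> 0"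
    using tendsto_diff[OF GD tendsto_scaleR[OF tendsto_const D, of "1 / 2"]] by simp
  \<comment> \<open>For the second claim \<open>G (w k)\<close> is replaced by
    \<open>G (w (Suc k))\<close>; the two differ by \<open>\<rho> *\<^sub>R G (D k)\<close>, which
    tends to 0.\<close>
  have "w (Suc k) = w k + \<rho> *\<^sub>R D k" for k
    by (simp add: D_def iter_w algebra_simps)
  then have step: "?G (w (Suc k)) - ?G (w k) = \<rho> *\<^sub>R ?G (D k)" for k
    by (simp flip: averaging_diff averaging_scaleR)
  have eq: "(r (Suc k) - ?G (w k)) - \<rho> *\<^sub>R ?G (D k) = r (Suc k) - ?G (w (Suc k))" for k
    by (simp flip: step)
  have "(\<lambda>k. r (Suc k) - ?G (w (Suc k))) \<longlonglongrightarrow> 0 - \<rho> *\<^sub>R 0"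
    unfolding eq[symmetric] by (intro tendsto_intros 1 GD)
  then have "(\<lambda>k. r (Suc k) - ?G (w (Suc k))) \<longlonglongrightarrow> 0" by simp
  then show "(\<lambda>k. r k - ?G (w k)) \<longlonglongrightarrow> 0"
    by (rule LIMSEQ_imp_Suc)
qed

lemma iter_bounded:
  assumes sol: "mace_solution \<sigma> \<upsilon> f ws"
  shows "bounded (range w)"
proof -
  have "norm (w k - ws) \<le> (\<Sum>i\<in>UNIV. sqrt (lyapunov ws (w 0) (r 0) / \<upsilon> i))" for k
  proof -
    have "norm ((w k - ws) $ i) \<le> sqrt (lyapunov ws (w 0) (r 0) / \<upsilon> i)" for i
    proof (rule real_le_rsqrt)
      have "weighted_sqnorm \<upsilon> (w k - ws) \<le> lyapunov ws (w 0) (r 0)"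
        using weighted_sqnorm_le_lyapunov decseqD[OF lyapunov_decseq[OF sol], of 0 k]
        by (meson le0 order_trans)
      then have "weighted_sqnorm \<upsilon> (w k - ws) / \<upsilon> i \<le> lyapunov ws (w 0) (r 0) / \<upsilon> i"
        using \<upsilon>(1)[of i] by (intro divide_right_mono) auto
      then show "(norm ((w k - ws) $ i))\<^sup>2 \<le> lyapunov ws (w 0) (r 0) / \<upsilon> i"
        by (rule order_trans[OF component_le_weighted_sqnorm[OF \<upsilon>(1)]])
    qed
    then have "(\<Sum>i\<in>UNIV. norm ((w k - ws) $ i)) \<le> (\<Sum>i\<in>UNIV. sqrt (lyapunov ws (w 0) (r 0) / \<upsilon> i))"
      by (intro sum_mono)
    moreover have "norm (w k - ws) \<le> (\<Sum>i\<in>UNIV. norm ((w k - ws) $ i))"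
      unfolding norm_vec_def by (rule L2_set_le_sum) simp
    ultimately show ?thesis by linarith
  qed
  then show ?thesis
    by (auto simp: bounded_any_center[where a = ws] dist_norm norm_minus_commute)
qed

text \<open>The inequality of \<open>prox_surrogate_subgradient\<close> no longer mentions the
  surrogate, so it passes to the limit by continuity of the convex \<open>f i\<close>. Both
  \<open>r (\<phi> k)\<close> and \<open>r (Suc (\<phi> k))\<close> tend to \<open>rl\<close> by
  consensus.\<close>

lemma cluster_point_mace_solution:
  assumes sol: "mace_solution \<sigma> \<upsilon> f ws"
    and \<phi>: "strict_mono \<phi>" and lim: "(w \<circ> \<phi>) \<longlonglongrightarrow> wl"
  shows "mace_solution \<sigma> \<upsilon> f wl" and "(r \<circ> \<phi>) \<longlonglongrightarrow> averaging \<upsilon> wl"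
proof -
  define rl where "rl = averaging \<upsilon> wl"
  have w: "(\<lambda>k. w (\<phi> k)) \<longlonglongrightarrow> wl" using lim by (simp add: o_def)
  have Gw: "(\<lambda>k. averaging \<upsilon> (w (\<phi> k))) \<longlonglongrightarrow> rl"
    unfolding rl_def by (rule tendsto_averaging[OF w])
  have r1: "(\<lambda>k. r (Suc (\<phi> k))) \<longlonglongrightarrow> rl"
    using tendsto_add[OF LIMSEQ_subseq_LIMSEQ[OF iter_consensus(1)[OF sol] \<phi>, unfolded o_def] Gw]
    by simp
  have r0: "(\<lambda>k. r (\<phi> k)) \<longlonglongrightarrow> rl"
    using tendsto_add[OF LIMSEQ_subseq_LIMSEQ[OF iter_consensus(2)[OF sol] \<phi>, unfolded o_def] Gw]
    by simp
  then show "(r \<circ> \<phi>) \<longlonglongrightarrow> averaging \<upsilon> wl" by (simp add: o_def rl_def)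
  have "prox \<sigma> (f i) (wl $ i) = rl $ i" for i
  proof (rule prox_eqI[OF \<sigma>])
    fix x
    have "continuous_on UNIV (f i)" using convex_on_continuous convex by blast
    then have f: "(\<lambda>k. f i (r (Suc (\<phi> k)) $ i)) \<longlonglongrightarrow> f i (rl $ i)"
      using r1 by (intro continuous_on_tendsto_compose[where f = "f i"] tendsto_intros) auto
    have "f i (rl $ i) + (wl $ i - rl $ i) \<bullet> (x - rl $ i) / \<sigma>\<^sup>2 + p i / 2 * (norm (x - rl $ i))\<^sup>2
      \<le> f i x + L i / 2 * (norm (x - rl $ i))\<^sup>2"
    proof (rule LIMSEQ_le)
      show "(\<lambda>k. f i (r (Suc (\<phi> k)) $ i) + (w (\<phi> k) $ i - r (Suc (\<phi> k)) $ i)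
          \<bullet> (x - r (Suc (\<phi> k)) $ i) / \<sigma>\<^sup>2 + p i / 2 * (norm (x - r (Suc (\<phi> k)) $ i))\<^sup>2)
        \<longlonglongrightarrow> f i (rl $ i) + (wl $ i - rl $ i) \<bullet> (x - rl $ i) / \<sigma>\<^sup>2 + p i / 2 * (norm (x - rl $ i))\<^sup>2"
        using \<sigma> by (intro tendsto_intros f w r1) auto
      show "(\<lambda>k. f i x + L i / 2 * (norm (x - r (\<phi> k) $ i))\<^sup>2)
        \<longlonglongrightarrow> f i x + L i / 2 * (norm (x - rl $ i))\<^sup>2"
        by (intro tendsto_intros r0)
      have "prox \<sigma> (fh k i) (w k $ i) = r (Suc k) $ i" for k
        by (simp add: iter_r stacked_prox_def)
      then show "\<exists>N. \<forall>k\<ge>N. f i (r (Suc (\<phi> k)) $ i) + (w (\<phi> k) $ i - r (Suc (\<phi> k)) $ i)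
          \<bullet> (x - r (Suc (\<phi> k)) $ i) / \<sigma>\<^sup>2 + p i / 2 * (norm (x - r (Suc (\<phi> k)) $ i))\<^sup>2
        \<le> f i x + L i / 2 * (norm (x - r (\<phi> k) $ i))\<^sup>2"
        using L[of i] p[of i] by (intro exI allI impI prox_surrogate_subgradient[OF iter_surrogate _ \<sigma>]) auto
    qed
    \<comment> \<open>In the limit both quadratic terms are centered at \<open>rl $ i\<close>, so
      \<open>p i \<ge> L i\<close> removes them.\<close>
    moreover have "L i / 2 * (norm (x - rl $ i))\<^sup>2 \<le> p i / 2 * (norm (x - rl $ i))\<^sup>2"
      using p by (intro mult_right_mono) auto
    ultimately show "f i (rl $ i) + (wl $ i - rl $ i) \<bullet> (x - rl $ i) / \<sigma>\<^sup>2 \<le> f i x"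
      by linarith
  qed
  then show "mace_solution \<sigma> \<upsilon> f wl"
    by (simp add: mace_solution_def stacked_prox_def vec_eq_iff rl_def)
qed

lemma iter_converges:
  assumes sol: "mace_solution \<sigma> \<upsilon> f ws"
  obtains wl where "mace_solution \<sigma> \<upsilon> f wl" "w \<longlonglongrightarrow> wl" "r \<longlonglongrightarrow> averaging \<upsilon> wl"
proof -
  obtain wl \<phi> where \<phi>: "strict_mono \<phi>" and lim: "(w \<circ> \<phi>) \<longlonglongrightarrow> wl"
    using bounded_imp_convergent_subsequence[OF iter_bounded[OF sol]] by blast
  note wl = cluster_point_mace_solution[OF sol \<phi> lim]
  let ?V = "\<lambda>k. lyapunov wl (w k) (r k)"
  obtain l where l: "?V \<longlonglongrightarrow> l" using lyapunov_convergent[OF wl(1)] .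
  have "(\<lambda>k. ?V (\<phi> k)) \<longlonglongrightarrow> 0"
    using tendsto_lyapunov[OF lim wl(2)] by (simp add: o_def)
  with LIMSEQ_subseq_LIMSEQ[OF l \<phi>] have "l = 0"
    by (auto simp: o_def intro: LIMSEQ_unique)
  with l have "?V \<longlonglongrightarrow> 0" by simp
  then have "(\<lambda>k. weighted_sqnorm \<upsilon> (w k - wl)) \<longlonglongrightarrow> 0"
    by (rule Lim_null_comparison[rotated])
      (simp add: always_eventually sqnorm_nonneg weighted_sqnorm_le_lyapunov)
  then have "(\<lambda>k. w k - wl) \<longlonglongrightarrow> 0"
    by (rule tendsto_zero_weighted_sqnorm[OF \<upsilon>(1)])
  then have w: "w \<longlonglongrightarrow> wl" by (simp add: LIM_zero_iff)
  \<comment> \<open>Some \<open>L i\<close> may be 0, so the Lyapunov function need not control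
    every component of \<open>r\<close>; consensus with \<open>G (w k)\<close> does.\<close>
  moreover have "r \<longlonglongrightarrow> averaging \<upsilon> wl"
    using tendsto_add[OF iter_consensus(2)[OF sol] tendsto_averaging[OF w, of \<upsilon>]] by simp
  ultimately show thesis using wl(1) that by blast
qed

end

end

theorem theorem1:
  fixes f :: "'m::finite \<Rightarrow> real ^ 'n \<Rightarrow> real"
    and L p \<upsilon> :: "'m \<Rightarrow> real"
    and \<sigma> \<rho> :: real
  assumes "\<sigma> > 0"
    and "0 < \<rho>" and "\<rho> < 1"
    and "\<And>i. \<upsilon> i > 0"
    and "(\<Sum>i\<in>UNIV. \<upsilon> i) = 1"
    and "\<And>i. convex_on UNIV (f i)"
    and "\<And>i. L i \<ge> 0"
    and "\<And>i. p i \<ge> L i"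
  shows "(\<forall>ws rs. augmented_fixed_point \<sigma> \<upsilon> L p f ws rs \<longrightarrow> mace_solution \<sigma> \<upsilon> f ws)
    \<and> ((\<exists>ws rs. augmented_fixed_point \<sigma> \<upsilon> L p f ws rs) \<longrightarrow>
        (\<forall>fh w r. augmented_iteration \<sigma> \<rho> \<upsilon> L p f fh w r \<longrightarrow>
          (\<exists>ws rs. augmented_fixed_point \<sigma> \<upsilon> L p f ws rs
                 \<and> w \<longlonglongrightarrow> ws \<and> r \<longlonglongrightarrow> rs
                 \<and> mace_solution \<sigma> \<upsilon> f ws)))"
proof -
  interpret mace f L p \<upsilon> \<sigma> \<rho> using assms by unfold_locales
  show ?thesis
  proof (intro conjI allI impI)
    fix fh w r
    assume "\<exists>ws rs. augmented_fixed_point \<sigma> \<upsilon> L p f ws rs"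
      and iter: "augmented_iteration \<sigma> \<rho> \<upsilon> L p f fh w r"
    then obtain ws where "mace_solution \<sigma> \<upsilon> f ws"
      using augmented_fixed_point_imp_mace_solution by blast
    from iter_converges[OF iter this] obtain wl
      where wl: "mace_solution \<sigma> \<upsilon> f wl" "w \<longlonglongrightarrow> wl" "r \<longlonglongrightarrow> averaging \<upsilon> wl" .
    then have "augmented_fixed_point \<sigma> \<upsilon> L p f wl (averaging \<upsilon> wl)"
      \<comment> \<open>The surrogates of iteration 0 witness that the quadratic surrogates at the
        limit are admissible.\<close>
      using mace_solution_imp_augmented_fixed_point[OF wl(1) iter_surrogate[OF iter, of 0]] by blast
    with wl show "\<exists>ws rs. augmented_fixed_point \<sigma> \<upsilon> L p f ws rs
        \<and> w \<longlonglongrightarrow> ws \<and> r \<longlonglongrightarrow> rs \<and> mace_solution \<sigma> \<upsilon> f ws"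
      by blast
  qed (rule augmented_fixed_point_imp_mace_solution)
qed

end
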